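(* Let $(M,g)$ be a Riemannian or Lorentzian manifold, $E$ a unitary vector field on $M$ (timelike in the Lorentzian case), $\varepsilon=g(E,E)$, $\omega=g(E,\cdot)$, $t\in\mathbb{R}\setminus\{-\varepsilon\}$, and let $g_t=g+t\,\omega\otimes\omega$ be the canonical variation of $g$ along $E$. If $X,Y$ are vector fields orthogonal to $E$, then $$g_t(R^t_{XY}Y,X)=g(R_{XY}Y,X)+\frac{t}{1+\varepsilon t}\Big(g(A_E(X),X)\,g(A_E(Y),Y)-g(A_E(X),Y)\,g(A_E(Y),X)-\frac{4+3\varepsilon t}{4}\,d\omega(X,Y)^2\Big).$$
   Context: Lorentzian metrics have signature $(-,+,\dots,+)$. Unitary means $g(E,E)=\pm1$ ($\varepsilon=1$ in the Riemannian case, $\varepsilon=-1$ in the Lorentzian case). $\nabla$ is the Levi-Civita connection of $g$; $R$ and $R^t$ are the curvature tensors of $g$ and $g_t$, with the convention $R_{UV}W=\nabla_U\nabla_VW-\nabla_V\nabla_UW-\nabla_{[U,V]}W$. $A_E(V)=\nabla_VE$. The exterior differential is normalized by $d\omega(U,V)=(\nabla_U\omega)(V)-(\nabla_V\omega)(U)$. *)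

theory Defs
  imports "HOL-Analysis.Analysis" "HOL-Library.Function_Algebras"
begin

text \<open>
  A smooth manifold is a Hausdorff, second countable space (the type \<open>'m\<close>) with a smooth atlas
  modelled on a Euclidean space (the type \<open>'e\<close>).  Tangent vectors at \<open>p\<close> are derivations at \<open>p\<close> of
  the algebra of smooth functions.  Sums, differences and products of functions are
  pointwise, by \<open>HOL-Library.Function_Algebras\<close>.
\<close>

subsection \<open>Smooth manifolds and smooth functions\<close>

primrec Ck_on :: "nat \<Rightarrow> 'e::real_normed_vector set \<Rightarrow> ('e \<Rightarrow> 'f::real_normed_vector) \<Rightarrow> bool" where
  "Ck_on 0 S f \<longleftrightarrow> continuous_on S f"
| "Ck_on (Suc k) S f \<longleftrightarrow> (\<forall>x\<in>S. f differentiable (at x)) \<and>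
     (\<forall>v. Ck_on k S (\<lambda>x. frechet_derivative f (at x) v))"

text \<open>Only used on open subsets of a Euclidean space.\<close>

definition Cinf_on :: "'e::real_normed_vector set \<Rightarrow> ('e \<Rightarrow> 'f::real_normed_vector) \<Rightarrow> bool" where
  "Cinf_on S f \<longleftrightarrow> (\<forall>k. Ck_on k S f)"

type_synonym ('m, 'e) atlas = "('m set \<times> ('m \<Rightarrow> 'e)) set"

definition chart :: "'m::topological_space set \<Rightarrow> ('m \<Rightarrow> 'e::euclidean_space) \<Rightarrow> bool" where
  "chart U \<phi> \<longleftrightarrow> open U \<and> open (\<phi> ` U) \<and> homeomorphism U (\<phi> ` U) \<phi> (inv_into U \<phi>)"

definition smooth_atlas ::
  "('m::{t2_space, second_countable_topology}, 'e::euclidean_space) atlas \<Rightarrow> bool" where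
  "smooth_atlas \<A> \<longleftrightarrow>
     (\<forall>(U, \<phi>)\<in>\<A>. chart U \<phi>) \<and>
     (\<Union>(U, \<phi>)\<in>\<A>. U) = UNIV \<and>
     (\<forall>(U, \<phi>)\<in>\<A>. \<forall>(V, \<psi>)\<in>\<A>. Cinf_on (\<phi> ` (U \<inter> V)) (\<psi> \<circ> inv_into U \<phi>))"

definition smooth_funs ::
  "('m::{t2_space, second_countable_topology}, 'e::euclidean_space) atlas \<Rightarrow> ('m \<Rightarrow> real) set" where
  "smooth_funs \<A> = {f. \<forall>(U, \<phi>)\<in>\<A>. Cinf_on (\<phi> ` U) (f \<circ> inv_into U \<phi>)}"

subsection \<open>Tangent vectors and vector fields\<close>

type_synonym 'm tangent = "('m \<Rightarrow> real) \<Rightarrow> real"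
type_synonym 'm vfield = "'m \<Rightarrow> 'm tangent"

definition tscale :: "real \<Rightarrow> 'm tangent \<Rightarrow> 'm tangent" (infixr \<open>*\<^sub>T\<close> 75) where
  "c *\<^sub>T v = (\<lambda>f. c * v f)"

text \<open>The last clause fixes the (irrelevant) value outside the smooth functions, so that equality of
  derivations is equality of functions.\<close>

definition tangent_space ::
  "('m::{t2_space, second_countable_topology}, 'e::euclidean_space) atlas \<Rightarrow> 'm \<Rightarrow> 'm tangent set" where
  "tangent_space \<A> p = {v.
     (\<forall>f\<in>smooth_funs \<A>. \<forall>h\<in>smooth_funs \<A>. v (f + h) = v f + v h) \<and>
     (\<forall>f\<in>smooth_funs \<A>. \<forall>c. v (\<lambda>q. c * f q) = c * v f) \<and>
     (\<forall>f\<in>smooth_funs \<A>. \<forall>h\<in>smooth_funs \<A>. v (f * h) = f p * v h + h p * v f) \<and>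
     (\<forall>f. f \<notin> smooth_funs \<A> \<longrightarrow> v f = 0)}"

definition smooth_vfields ::
  "('m::{t2_space, second_countable_topology}, 'e::euclidean_space) atlas \<Rightarrow> 'm vfield set" where
  "smooth_vfields \<A> = {X. (\<forall>p. X p \<in> tangent_space \<A> p) \<and>
     (\<forall>f\<in>smooth_funs \<A>. (\<lambda>p. X p f) \<in> smooth_funs \<A>)}"

definition vfscale :: "('m \<Rightarrow> real) \<Rightarrow> 'm vfield \<Rightarrow> 'm vfield" (infixr \<open>*\<^sub>V\<close> 75) where
  "h *\<^sub>V X = (\<lambda>p. h p *\<^sub>T X p)"

definition lie_bracket :: "'m vfield \<Rightarrow> 'm vfield \<Rightarrow> 'm vfield" where
  "lie_bracket X Y = (\<lambda>p f. X p (\<lambda>q. Y q f) - Y p (\<lambda>q. X q f))"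


subsection \<open>Metrics\<close>

type_synonym 'm oneform = "'m \<Rightarrow> 'm tangent \<Rightarrow> real"
type_synonym 'm tensor2 = "'m \<Rightarrow> 'm tangent \<Rightarrow> 'm tangent \<Rightarrow> real"

definition smooth_sym_tensor ::
  "('m::{t2_space, second_countable_topology}, 'e::euclidean_space) atlas \<Rightarrow> 'm tensor2 \<Rightarrow> bool" where
  "smooth_sym_tensor \<A> g \<longleftrightarrow>
     (\<forall>p. \<forall>u\<in>tangent_space \<A> p. \<forall>v\<in>tangent_space \<A> p. g p u v = g p v u) \<and>
     (\<forall>p. \<forall>u\<in>tangent_space \<A> p. \<forall>v\<in>tangent_space \<A> p. \<forall>w\<in>tangent_space \<A> p.
        g p (u + v) w = g p u w + g p v w) \<and>
     (\<forall>p. \<forall>u\<in>tangent_space \<A> p. \<forall>v\<in>tangent_space \<A> p. \<forall>c. g p (c *\<^sub>T u) v = c * g p u v) \<and>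
     (\<forall>X\<in>smooth_vfields \<A>. \<forall>Y\<in>smooth_vfields \<A>. (\<lambda>p. g p (X p) (Y p)) \<in> smooth_funs \<A>)"

definition riemannian_metric ::
  "('m::{t2_space, second_countable_topology}, 'e::euclidean_space) atlas \<Rightarrow> 'm tensor2 \<Rightarrow> bool" where
  "riemannian_metric \<A> g \<longleftrightarrow> smooth_sym_tensor \<A> g \<and>
     (\<forall>p. \<forall>v\<in>tangent_space \<A> p. v \<noteq> 0 \<longrightarrow> 0 < g p v v)"

text \<open>Signature \<open>(-,+,\<dots>,+)\<close>: each tangent space has a basis \<open>e 0, \<dots>, e (n - 1)\<close> in which the
  metric is \<open>diag(-1, 1, \<dots>, 1)\<close>; linear independence follows from orthonormality.\<close>

definition lorentzian_metric ::
  "('m::{t2_space, second_countable_topology}, 'e::euclidean_space) atlas \<Rightarrow> 'm tensor2 \<Rightarrow> bool" where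
  "lorentzian_metric \<A> g \<longleftrightarrow> smooth_sym_tensor \<A> g \<and>
     (\<forall>p. \<exists>e. (\<forall>i<DIM('e). e i \<in> tangent_space \<A> p) \<and>
        (\<forall>v\<in>tangent_space \<A> p. \<exists>c. v = (\<Sum>i<DIM('e). c i *\<^sub>T e i)) \<and>
        (\<forall>i<DIM('e). \<forall>j<DIM('e).
           g p (e i) (e j) = (if i \<noteq> j then 0 else if i = 0 then -1 else 1)))"

definition flat :: "'m tensor2 \<Rightarrow> 'm vfield \<Rightarrow> 'm oneform" where
  "flat g E = (\<lambda>p v. g p (E p) v)"

definition canonical_variation :: "'m tensor2 \<Rightarrow> 'm vfield \<Rightarrow> real \<Rightarrow> 'm tensor2" where
  "canonical_variation g E t = (\<lambda>p u v. g p u v + t * (flat g E p u * flat g E p v))"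

subsection \<open>Connections and curvature\<close>

type_synonym 'm connection = "'m vfield \<Rightarrow> 'm vfield \<Rightarrow> 'm vfield"

definition affine_connection ::
  "('m::{t2_space, second_countable_topology}, 'e::euclidean_space) atlas \<Rightarrow> 'm connection \<Rightarrow> bool" where
  "affine_connection \<A> D \<longleftrightarrow>
     (\<forall>X\<in>smooth_vfields \<A>. \<forall>Y\<in>smooth_vfields \<A>. D X Y \<in> smooth_vfields \<A>) \<and>
     (\<forall>X\<in>smooth_vfields \<A>. \<forall>Y\<in>smooth_vfields \<A>. \<forall>Z\<in>smooth_vfields \<A>.
        D (X + Y) Z = D X Z + D Y Z \<and> D X (Y + Z) = D X Y + D X Z) \<and>
     (\<forall>h\<in>smooth_funs \<A>. \<forall>X\<in>smooth_vfields \<A>. \<forall>Y\<in>smooth_vfields \<A>.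
        D (h *\<^sub>V X) Y = h *\<^sub>V D X Y \<and>
        D X (h *\<^sub>V Y) = (\<lambda>p. X p h) *\<^sub>V Y + h *\<^sub>V D X Y)"

definition levi_civita ::
  "('m::{t2_space, second_countable_topology}, 'e::euclidean_space) atlas \<Rightarrow> 'm tensor2 \<Rightarrow>
   'm connection \<Rightarrow> bool" where
  "levi_civita \<A> g D \<longleftrightarrow> affine_connection \<A> D \<and>
     (\<forall>X\<in>smooth_vfields \<A>. \<forall>Y\<in>smooth_vfields \<A>. D X Y - D Y X = lie_bracket X Y) \<and>
     (\<forall>X\<in>smooth_vfields \<A>. \<forall>Y\<in>smooth_vfields \<A>. \<forall>Z\<in>smooth_vfields \<A>. \<forall>p.
        X p (\<lambda>q. g q (Y q) (Z q)) = g p (D X Y p) (Z p) + g p (Y p) (D X Z p))"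

definition curvature :: "'m connection \<Rightarrow> 'm vfield \<Rightarrow> 'm vfield \<Rightarrow> 'm vfield \<Rightarrow> 'm vfield" where
  "curvature D U V W = D U (D V W) - D V (D U W) - D (lie_bracket U V) W"

definition A_op :: "'m connection \<Rightarrow> 'm vfield \<Rightarrow> 'm vfield \<Rightarrow> 'm vfield" where
  "A_op D E V = D V E"

text \<open>\<open>(\<nabla>\<^sub>U \<omega>)(V)\<close>\<close>

definition cov_deriv_form ::
  "'m connection \<Rightarrow> 'm oneform \<Rightarrow> 'm vfield \<Rightarrow> 'm vfield \<Rightarrow> 'm \<Rightarrow> real" where
  "cov_deriv_form D \<omega> U V = (\<lambda>p. U p (\<lambda>q. \<omega> q (V q)) - \<omega> p (D U V p))"

text \<open>The exterior differential of a 1-form, with its normalization fixed through a torsion-free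
  connection.  By the lemma below it does not depend on that connection.\<close>

definition ext_deriv ::
  "'m connection \<Rightarrow> 'm oneform \<Rightarrow> 'm vfield \<Rightarrow> 'm vfield \<Rightarrow> 'm \<Rightarrow> real" where
  "ext_deriv D \<omega> U V = (\<lambda>p. cov_deriv_form D \<omega> U V p - cov_deriv_form D \<omega> V U p)"

lemma tangent_space_diff:
  assumes "u \<in> tangent_space \<A> p" "v \<in> tangent_space \<A> p"
  shows "u - v \<in> tangent_space \<A> p"
  using assms by (simp add: tangent_space_def algebra_simps)

lemma ext_deriv_invariant_formula:
  assumes D: "levi_civita \<A> g D" and U: "U \<in> smooth_vfields \<A>" and V: "V \<in> smooth_vfields \<A>"
    and add: "\<And>u v. u \<in> tangent_space \<A> p \<Longrightarrow> v \<in> tangent_space \<A> p \<Longrightarrow>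
      \<omega> p (u + v) = \<omega> p u + \<omega> p v"
  shows "ext_deriv D \<omega> U V p =
    U p (\<lambda>q. \<omega> q (V q)) - V p (\<lambda>q. \<omega> q (U q)) - \<omega> p (lie_bracket U V p)"
proof -
  have "D U V \<in> smooth_vfields \<A>" "D V U \<in> smooth_vfields \<A>"
    using D U V by (auto simp: levi_civita_def affine_connection_def)
  then have DUV: "D U V p \<in> tangent_space \<A> p" and DVU: "D V U p \<in> tangent_space \<A> p"
    by (auto simp: smooth_vfields_def)
  have "D U V - D V U = lie_bracket U V"
    using D U V by (simp add: levi_civita_def)
  then have L: "lie_bracket U V p = D U V p - D V U p"
    by (metis minus_apply)
  have "\<omega> p (D U V p) = \<omega> p (lie_bracket U V p) + \<omega> p (D V U p)"
    using add[OF tangent_space_diff[OF DUV DVU] DVU] by (simp add: L)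
  then show ?thesis
    by (simp add: ext_deriv_def cov_deriv_form_def)
qed

end

theory Submission imports Defs begin

text \<open>
  Write \<open>g\<^sub>t\<close> for the canonical variation and \<open>\<omega>\<close> for the 1-form \<open>g(E, _)\<close>.  Moving derivatives off the
  second derivatives of \<open>Y\<close> by metric compatibility gives
  \<open>g(R\<^sub>X\<^sub>Y Y, X) = X g(D\<^sub>Y Y, X) - g(D\<^sub>Y Y, D\<^sub>X X) - Y g(D\<^sub>X Y, X) + g(D\<^sub>X Y, D\<^sub>Y X) - g(D\<^bsub>[X,Y]\<^esub> Y, X)\<close>
  for every metric (\<open>metric_curvature_expansion\<close>), so that only the first covariant derivatives of
  the two connections have to be compared.

  That comparison comes from the Koszul formula.  If two of the fields \<open>U, V, W\<close> are orthogonal to \<open>E\<close>,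
  then \<open>g\<close> and \<open>g\<^sub>t\<close> agree on each pair of them, all derivative terms coincide, and the two formulas
  differ only in the terms \<open>t \<omega>([U,V]) \<omega>(W)\<close> and its permutations
  (\<open>canonical_variation_koszul_comparison\<close>).  For \<open>U, V\<close> orthogonal to \<open>E\<close> this determines
  \<open>g\<^sub>t(Dt\<^sub>U V, W)\<close> for every \<open>W\<close>.  The choice \<open>W = E\<close> yields \<open>(1 + \<epsilon>t) \<omega>(Dt\<^sub>U V)\<close>, which is where
  \<open>t \<noteq> -\<epsilon>\<close> enters.  The quadratic terms such as \<open>g\<^sub>t(Dt\<^sub>Y Y, Dt\<^sub>X X)\<close> are then found by
  applying the same identity twice, with \<open>W\<close> itself a covariant derivative
  (\<open>canonical_variation_pairing_of_derivatives\<close>): the difference of the two connections is only ever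
  seen through its pairings with smooth fields.

  Finally \<open>\<omega>(D\<^sub>U V) = -g(A\<^sub>E U, V)\<close> for \<open>V\<close> orthogonal to \<open>E\<close>, whence
  \<open>\<omega>([X,Y]) = -d\<omega>(X,Y)\<close>, and the theorem becomes an identity of rational functions in the four
  numbers \<open>g(A\<^sub>E X, X)\<close>, \<open>g(A\<^sub>E Y, Y)\<close>, \<open>g(A\<^sub>E X, Y)\<close>, \<open>g(A\<^sub>E Y, X)\<close>.
\<close>

section \<open>Smoothness of differences and of brackets\<close>

text \<open>On an open set the Frechet derivative only sees the values in that set.\<close>

lemma Ck_on_cong_open:
  assumes "open S" "\<And>x. x \<in> S \<Longrightarrow> f x = h x" "Ck_on k S f"
  shows "Ck_on k S h"
  using assms(2,3)
proof (induction k arbitrary: f h)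
  case 0
  then show ?case
    by (simp cong: continuous_on_cong)
next
  case (Suc k)
  have der: "(h has_derivative frechet_derivative f (at x)) (at x)" if "x \<in> S" for x
  proof -
    have "(f has_derivative frechet_derivative f (at x)) (at x)"
      using Suc.prems(2) that by (simp add: frechet_derivative_works)
    then show ?thesis
      by (rule has_derivative_transform_within_open[OF _ assms(1) that]) (simp add: Suc.prems(1))
  qed
  have eq: "frechet_derivative f (at x) = frechet_derivative h (at x)" if "x \<in> S" for x
    using der[OF that] by (rule frechet_derivative_at)
  show ?case
  proof (simp, intro conjI ballI allI)
    show "h differentiable at x" if "x \<in> S" for x
      using der[OF that] by (auto simp: differentiable_def)
    show "Ck_on k S (\<lambda>x. frechet_derivative h (at x) v)" for v
      by (rule Suc.IH[of "\<lambda>x. frechet_derivative f (at x) v"]) (use eq Suc.prems(2) in auto)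
  qed
qed

lemma Ck_on_diff:
  assumes "open S" "Ck_on k S f" "Ck_on k S h"
  shows "Ck_on k S (\<lambda>x. f x - h x)"
  using assms(2,3)
proof (induction k arbitrary: f h)
  case 0
  then show ?case
    by (simp add: continuous_on_diff)
next
  case (Suc k)
  have der: "((\<lambda>x. f x - h x) has_derivative
      (\<lambda>v. frechet_derivative f (at x) v - frechet_derivative h (at x) v)) (at x)" if "x \<in> S" for x
    using Suc.prems that by (intro has_derivative_diff) (simp_all add: frechet_derivative_works)
  show ?case
  proof (simp, intro conjI ballI allI)
    show "(\<lambda>x. f x - h x) differentiable at x" if "x \<in> S" for x
      using der[OF that] by (auto simp: differentiable_def)
    fix v
    have "Ck_on k S (\<lambda>x. frechet_derivative f (at x) v - frechet_derivative h (at x) v)"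
      by (rule Suc.IH) (use Suc.prems in auto)
    then show "Ck_on k S (\<lambda>x. frechet_derivative (\<lambda>x. f x - h x) (at x) v)"
      by (rule Ck_on_cong_open[OF assms(1), rotated])
        (use frechet_derivative_at[OF der] in metis)
  qed
qed

lemma smooth_funs_diff:
  assumes "smooth_atlas \<A>" "f \<in> smooth_funs \<A>" "h \<in> smooth_funs \<A>"
  shows "(\<lambda>p. f p - h p) \<in> smooth_funs \<A>"
proof -
  have "Cinf_on (\<phi> ` U) ((\<lambda>p. f p - h p) \<circ> inv_into U \<phi>)" if "(U, \<phi>) \<in> \<A>" for U \<phi>
  proof -
    have "open (\<phi> ` U)"
      using assms(1) that by (auto simp: smooth_atlas_def chart_def)
    moreover have "Cinf_on (\<phi> ` U) (f \<circ> inv_into U \<phi>)" "Cinf_on (\<phi> ` U) (h \<circ> inv_into U \<phi>)"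
      using assms(2,3) that by (auto simp: smooth_funs_def)
    ultimately show ?thesis
      using Ck_on_diff[of "\<phi> ` U" _ "f \<circ> inv_into U \<phi>" "h \<circ> inv_into U \<phi>"]
      by (simp add: Cinf_on_def comp_def)
  qed
  then show ?thesis
    by (auto simp: smooth_funs_def)
qed

lemma smooth_vfields_diff:
  assumes "smooth_atlas \<A>" "U \<in> smooth_vfields \<A>" "V \<in> smooth_vfields \<A>"
  shows "U - V \<in> smooth_vfields \<A>"
  using assms by (auto simp: smooth_vfields_def intro: tangent_space_diff smooth_funs_diff)

lemma smooth_vfields_tangent: "U \<in> smooth_vfields \<A> \<Longrightarrow> U p \<in> tangent_space \<A> p"
  by (simp add: smooth_vfields_def)

lemma levi_civita_smooth:
  assumes "levi_civita \<A> g D" "U \<in> smooth_vfields \<A>" "V \<in> smooth_vfields \<A>"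
  shows "D U V \<in> smooth_vfields \<A>"
  using assms by (auto simp: levi_civita_def affine_connection_def)

text \<open>The bracket equals \<open>D\<^sub>U V - D\<^sub>V U\<close>, so its smoothness is inherited from the connection and needs
  no computation with iterated derivations.\<close>

lemma lie_bracket_smooth:
  assumes "smooth_atlas \<A>" "levi_civita \<A> g D" "U \<in> smooth_vfields \<A>" "V \<in> smooth_vfields \<A>"
  shows "lie_bracket U V \<in> smooth_vfields \<A>"
proof -
  have "D U V - D V U = lie_bracket U V"
    using assms by (simp add: levi_civita_def)
  then show ?thesis
    using smooth_vfields_diff[OF assms(1) levi_civita_smooth[OF assms(2-4)]
        levi_civita_smooth[OF assms(2,4,3)]] by simp
qed

text \<open>Any smooth \<open>f\<close> serves to write the zero function as \<open>0 \<cdot> f\<close>, on which homogeneity of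
  tangent vectors applies.\<close>

lemma tangent_zero_fun:
  assumes "v \<in> tangent_space \<A> p" "f \<in> smooth_funs \<A>"
  shows "v (\<lambda>q. 0) = 0"
proof -
  have "v (\<lambda>q. 0 * f q) = 0 * v f"
    using assms unfolding tangent_space_def by blast
  then show ?thesis
    by simp
qed


section \<open>Koszul formula and curvature for a compatible pairing\<close>

text \<open>The algebraic part of a metric on which the Koszul formula and the curvature expansion rest.  It is
  separated from smoothness because it passes from \<open>g\<close> to the canonical variation by pure algebra, so
  that both formulas apply to either metric.  Additivity is stated for differences, the form in which
  torsion-freeness and the curvature present their terms.\<close>

definition symmetric_pairing ::
  "('m::{t2_space, second_countable_topology}, 'e::euclidean_space) atlas \<Rightarrow> 'm tensor2 \<Rightarrow> bool" where
  "symmetric_pairing \<A> g \<longleftrightarrow>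
     (\<forall>p. \<forall>u\<in>tangent_space \<A> p. \<forall>v\<in>tangent_space \<A> p. g p u v = g p v u) \<and>
     (\<forall>p. \<forall>u\<in>tangent_space \<A> p. \<forall>v\<in>tangent_space \<A> p. \<forall>w\<in>tangent_space \<A> p.
        g p (u - v) w = g p u w - g p v w)"

lemma symmetric_pairing_commute:
  assumes "symmetric_pairing \<A> g" "U \<in> smooth_vfields \<A>" "V \<in> smooth_vfields \<A>"
  shows "g p (U p) (V p) = g p (V p) (U p)"
  using assms by (simp add: symmetric_pairing_def smooth_vfields_tangent)

lemma symmetric_pairing_diff:
  assumes "symmetric_pairing \<A> g"
    and "U \<in> smooth_vfields \<A>" "V \<in> smooth_vfields \<A>" "W \<in> smooth_vfields \<A>"
  shows "g p ((U - V) p) (W p) = g p (U p) (W p) - g p (V p) (W p)"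
  using assms by (simp add: symmetric_pairing_def smooth_vfields_tangent)

lemma smooth_sym_tensor_pairing:
  assumes "smooth_sym_tensor \<A> g"
  shows "symmetric_pairing \<A> g"
proof -
  have "g p (u - v) w = g p u w - g p v w"
    if "u \<in> tangent_space \<A> p" "v \<in> tangent_space \<A> p" "w \<in> tangent_space \<A> p" for p u v w
  proof -
    have "g p ((u - v) + v) w = g p (u - v) w + g p v w"
      using assms that tangent_space_diff[OF that(1,2)] unfolding smooth_sym_tensor_def by blast
    then show ?thesis
      by simp
  qed
  moreover have "g p u v = g p v u"
    if "u \<in> tangent_space \<A> p" "v \<in> tangent_space \<A> p" for p u v
    using assms that unfolding smooth_sym_tensor_def by blast
  ultimately show ?thesis
    unfolding symmetric_pairing_def by blast
qed

lemma canonical_variation_pairing: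
  assumes g: "symmetric_pairing \<A> g" and E: "E \<in> smooth_vfields \<A>"
  shows "symmetric_pairing \<A> (canonical_variation g E t)"
proof -
  have sym: "g p u v = g p v u"
    if "u \<in> tangent_space \<A> p" "v \<in> tangent_space \<A> p" for p u v
    using g that unfolding symmetric_pairing_def by blast
  have diff: "g p (u - v) w = g p u w - g p v w"
    if "u \<in> tangent_space \<A> p" "v \<in> tangent_space \<A> p" "w \<in> tangent_space \<A> p" for p u v w
    using g that unfolding symmetric_pairing_def by blast
  have diff_flat: "g p (E p) (u - v) = g p (E p) u - g p (E p) v"
    if "u \<in> tangent_space \<A> p" "v \<in> tangent_space \<A> p" for p u v
    using that smooth_vfields_tangent[OF E, of p]
    by (metis sym diff tangent_space_diff)
  show ?thesis
    unfolding symmetric_pairing_def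
    using sym by (auto simp: canonical_variation_def flat_def diff diff_flat algebra_simps)
qed

lemma levi_civita_compatible:
  assumes "levi_civita \<A> g D"
    and "U \<in> smooth_vfields \<A>" "V \<in> smooth_vfields \<A>" "W \<in> smooth_vfields \<A>"
  shows "U p (\<lambda>q. g q (V q) (W q)) = g p (D U V p) (W p) + g p (V p) (D U W p)"
  using assms unfolding levi_civita_def by blast

lemma levi_civita_bracket:
  assumes "levi_civita \<A> g D" "symmetric_pairing \<A> h"
    and "U \<in> smooth_vfields \<A>" "V \<in> smooth_vfields \<A>" "W \<in> smooth_vfields \<A>"
  shows "h p (lie_bracket U V p) (W p) = h p (D U V p) (W p) - h p (D V U p) (W p)"
proof -
  have "D U V - D V U = lie_bracket U V"
    using assms by (simp add: levi_civita_def)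
  then show ?thesis
    using symmetric_pairing_diff[OF assms(2) levi_civita_smooth[OF assms(1,3,4)]
        levi_civita_smooth[OF assms(1,4,3)] assms(5)] by simp
qed

lemma koszul_formula:
  assumes LC: "levi_civita \<A> g D" and g: "symmetric_pairing \<A> g"
    and U: "U \<in> smooth_vfields \<A>" and V: "V \<in> smooth_vfields \<A>" and W: "W \<in> smooth_vfields \<A>"
  shows "2 * g p (D U V p) (W p) =
    U p (\<lambda>q. g q (V q) (W q)) + V p (\<lambda>q. g q (U q) (W q)) - W p (\<lambda>q. g q (U q) (V q))
    + g p (lie_bracket U V p) (W p) - g p (lie_bracket U W p) (V p) - g p (lie_bracket V W p) (U p)"
  using levi_civita_compatible[OF LC U V W, of p] levi_civita_compatible[OF LC V U W, of p]
    levi_civita_compatible[OF LC W U V, of p]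
    levi_civita_bracket[OF LC g U V W, of p] levi_civita_bracket[OF LC g U W V, of p]
    levi_civita_bracket[OF LC g V W U, of p]
    symmetric_pairing_commute[OF g V levi_civita_smooth[OF LC U W], of p]
    symmetric_pairing_commute[OF g U levi_civita_smooth[OF LC V W], of p]
    symmetric_pairing_commute[OF g U levi_civita_smooth[OF LC W V], of p]
  by linarith

text \<open>Metric compatibility moves the outer derivative of \<open>D\<^sub>U D\<^sub>V Z\<close> onto the test field, so that
  a connection enters only through pairings of its first derivatives.\<close>

lemma metric_curvature_expansion:
  assumes atlas: "smooth_atlas \<A>" and LC: "levi_civita \<A> g D" and g: "symmetric_pairing \<A> g"
    and U: "U \<in> smooth_vfields \<A>" and V: "V \<in> smooth_vfields \<A>"
    and Z: "Z \<in> smooth_vfields \<A>" and W: "W \<in> smooth_vfields \<A>"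
  shows "g p (curvature D U V Z p) (W p) =
    U p (\<lambda>q. g q (D V Z q) (W q)) - g p (D V Z p) (D U W p)
    - V p (\<lambda>q. g q (D U Z q) (W q)) + g p (D U Z p) (D V W p)
    - g p (D (lie_bracket U V) Z p) (W p)"
proof -
  note smooth = levi_civita_smooth[OF LC]
  have UVZ: "D U (D V Z) \<in> smooth_vfields \<A>" and VUZ: "D V (D U Z) \<in> smooth_vfields \<A>"
    by (intro smooth U V Z)+
  have BZ: "D (lie_bracket U V) Z \<in> smooth_vfields \<A>"
    by (intro smooth lie_bracket_smooth[OF atlas LC] U V Z)
  have "g p (curvature D U V Z p) (W p) =
      g p (D U (D V Z) p) (W p) - g p (D V (D U Z) p) (W p) - g p (D (lie_bracket U V) Z p) (W p)"
    unfolding curvature_def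
    using symmetric_pairing_diff[OF g smooth_vfields_diff[OF atlas UVZ VUZ] BZ W, of p]
      symmetric_pairing_diff[OF g UVZ VUZ W, of p] by linarith
  then show ?thesis
    using levi_civita_compatible[OF LC U smooth[OF V Z] W, of p]
      levi_civita_compatible[OF LC V smooth[OF U Z] W, of p] by linarith
qed


section \<open>The Levi-Civita connection of the canonical variation\<close>

text \<open>Since two of the three fields are orthogonal to \<open>E\<close>, one member of each pair is, so
  \<open>\<omega> \<otimes> \<omega>\<close> vanishes identically on each pair and the derivative terms of the two Koszul formulas are
  equal.\<close>

lemma canonical_variation_koszul_comparison:
  assumes g: "symmetric_pairing \<A> g" and E: "E \<in> smooth_vfields \<A>"
    and LC: "levi_civita \<A> g D" and LCt: "levi_civita \<A> (canonical_variation g E t) Dt"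
    and U: "U \<in> smooth_vfields \<A>" and V: "V \<in> smooth_vfields \<A>" and W: "W \<in> smooth_vfields \<A>"
    and orthV: "\<And>q. flat g E q (V q) = 0"
    and orthUW: "(\<forall>q. flat g E q (U q) = 0) \<or> (\<forall>q. flat g E q (W q) = 0)"
  shows "2 * canonical_variation g E t p (Dt U V p) (W p) =
    2 * g p (D U V p) (W p)
    + t * (flat g E p (lie_bracket U V p) * flat g E p (W p)
           - flat g E p (lie_bracket V W p) * flat g E p (U p))"
proof -
  have eq: "(\<lambda>q. canonical_variation g E t q (V q) (W q)) = (\<lambda>q. g q (V q) (W q))"
    "(\<lambda>q. canonical_variation g E t q (U q) (W q)) = (\<lambda>q. g q (U q) (W q))"
    "(\<lambda>q. canonical_variation g E t q (U q) (V q)) = (\<lambda>q. g q (U q) (V q))"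
    using orthV orthUW by (auto simp: canonical_variation_def)
  show ?thesis
    using koszul_formula[OF LC g U V W, of p]
      koszul_formula[OF LCt canonical_variation_pairing[OF g E] U V W, of p]
    unfolding eq by (simp add: canonical_variation_def orthV algebra_simps)
qed

text \<open>The comparison with test field \<open>E\<close>.  The factor \<open>1 + \<epsilon>t\<close> arises because
  \<open>g\<^sub>t(E, _) = (1 + \<epsilon>t) \<omega>\<close>.\<close>

lemma canonical_variation_flat_derivative:
  assumes g: "symmetric_pairing \<A> g" and E: "E \<in> smooth_vfields \<A>"
    and LC: "levi_civita \<A> g D" and LCt: "levi_civita \<A> (canonical_variation g E t) Dt"
    and U: "U \<in> smooth_vfields \<A>" and V: "V \<in> smooth_vfields \<A>"
    and orthU: "\<And>q. flat g E q (U q) = 0" and orthV: "\<And>q. flat g E q (V q) = 0"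
    and unit: "g p (E p) (E p) = \<epsilon>"
  shows "2 * (1 + \<epsilon> * t) * flat g E p (Dt U V p) =
    2 * flat g E p (D U V p) + \<epsilon> * t * flat g E p (lie_bracket U V p)"
  using canonical_variation_koszul_comparison[OF g E LC LCt U V E orthV, of p] orthU unit
    symmetric_pairing_commute[OF g E levi_civita_smooth[OF LC U V], of p]
    symmetric_pairing_commute[OF g E levi_civita_smooth[OF LCt U V], of p]
  by (simp add: canonical_variation_def flat_def algebra_simps)

text \<open>The comparison is used twice: with the test field \<open>Dt U' V'\<close> it replaces \<open>Dt U V\<close> by \<open>D U V\<close>, and
  with the test field \<open>D U V\<close> it then replaces \<open>Dt U' V'\<close> by \<open>D U' V'\<close>.  Between the two uses one
  passes from \<open>g\<close> back to \<open>g\<^sub>t\<close>, at the cost of the last term.\<close>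

lemma canonical_variation_pairing_of_derivatives:
  assumes g: "symmetric_pairing \<A> g" and E: "E \<in> smooth_vfields \<A>"
    and LC: "levi_civita \<A> g D" and LCt: "levi_civita \<A> (canonical_variation g E t) Dt"
    and U: "U \<in> smooth_vfields \<A>" and V: "V \<in> smooth_vfields \<A>"
    and U': "U' \<in> smooth_vfields \<A>" and V': "V' \<in> smooth_vfields \<A>"
    and orthU: "\<And>q. flat g E q (U q) = 0" and orthV: "\<And>q. flat g E q (V q) = 0"
    and orthU': "\<And>q. flat g E q (U' q) = 0" and orthV': "\<And>q. flat g E q (V' q) = 0"
  shows "canonical_variation g E t p (Dt U V p) (Dt U' V' p) =
    g p (D U V p) (D U' V' p)
    + t / 2 * (flat g E p (lie_bracket U V p) * flat g E p (Dt U' V' p)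
               + flat g E p (lie_bracket U' V' p) * flat g E p (D U V p))
    - t * flat g E p (Dt U' V' p) * flat g E p (D U V p)"
proof -
  note smooth = levi_civita_smooth[OF LC U V] levi_civita_smooth[OF LC U' V']
    levi_civita_smooth[OF LCt U' V']
  have "2 * canonical_variation g E t p (Dt U V p) (Dt U' V' p) =
      2 * g p (D U V p) (Dt U' V' p)
      + t * flat g E p (lie_bracket U V p) * flat g E p (Dt U' V' p)"
    using canonical_variation_koszul_comparison[OF g E LC LCt U V smooth(3) orthV, of p] orthU
    by simp
  moreover have "2 * canonical_variation g E t p (Dt U' V' p) (D U V p) =
      2 * g p (D U' V' p) (D U V p) + t * flat g E p (lie_bracket U' V' p) * flat g E p (D U V p)"
    using canonical_variation_koszul_comparison[OF g E LC LCt U' V' smooth(1) orthV', of p] orthU'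
    by simp
  moreover have "g p (D U V p) (Dt U' V' p) =
      canonical_variation g E t p (Dt U' V' p) (D U V p)
      - t * flat g E p (Dt U' V' p) * flat g E p (D U V p)"
    using symmetric_pairing_commute[OF g smooth(1) smooth(3), of p]
    by (simp add: canonical_variation_def)
  moreover have "g p (D U' V' p) (D U V p) = g p (D U V p) (D U' V' p)"
    by (rule symmetric_pairing_commute[OF g smooth(2) smooth(1)])
  ultimately show ?thesis
    by (simp add: algebra_simps)
qed

text \<open>Differentiate the constant function \<open>g(V, E) = 0\<close> along \<open>U\<close>.\<close>

lemma flat_derivative_orthogonal:
  assumes g: "smooth_sym_tensor \<A> g" and LC: "levi_civita \<A> g D"
    and E: "E \<in> smooth_vfields \<A>" and U: "U \<in> smooth_vfields \<A>" and V: "V \<in> smooth_vfields \<A>"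
    and orth: "\<And>q. flat g E q (V q) = 0"
  shows "flat g E p (D U V p) = - g p (A_op D E U p) (V p)"
proof -
  have "(\<lambda>q. g q (E q) (V q)) \<in> smooth_funs \<A>"
    using g E V by (simp add: smooth_sym_tensor_def)
  then have "U p (\<lambda>q. g q (E q) (V q)) = 0"
    using tangent_zero_fun[OF smooth_vfields_tangent[OF U]] orth by (simp add: flat_def)
  then show ?thesis
    using levi_civita_compatible[OF LC U E V, of p] by (simp add: flat_def A_op_def)
qed


section \<open>Curvature of the canonical variation on planes orthogonal to the unitary field\<close>

theorem theorem3p6:
  fixes \<A> :: "('m::{t2_space, second_countable_topology}, 'e::euclidean_space) atlas"
    and g :: "'m tensor2" and E X Y :: "'m vfield"
    and \<epsilon> t :: real and D Dt :: "'m connection"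
  assumes manifold: "smooth_atlas \<A>"
    and metric: "riemannian_metric \<A> g \<and> \<epsilon> = 1 \<or> lorentzian_metric \<A> g \<and> \<epsilon> = -1"
    and E: "E \<in> smooth_vfields \<A>"
    and unitary: "\<forall>p. g p (E p) (E p) = \<epsilon>"
    and t: "t \<noteq> -\<epsilon>"
    and LC: "levi_civita \<A> g D"
    and LCt: "levi_civita \<A> (canonical_variation g E t) Dt"
    and X: "X \<in> smooth_vfields \<A>" "\<forall>p. g p (X p) (E p) = 0"
    and Y: "Y \<in> smooth_vfields \<A>" "\<forall>p. g p (Y p) (E p) = 0"
  shows "\<forall>p. canonical_variation g E t p (curvature Dt X Y Y p) (X p) =
    g p (curvature D X Y Y p) (X p) +
    t / (1 + \<epsilon> * t) *
      (g p (A_op D E X p) (X p) * g p (A_op D E Y p) (Y p)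
       - g p (A_op D E X p) (Y p) * g p (A_op D E Y p) (X p)
       - (4 + 3 * \<epsilon> * t) / 4 * (ext_deriv D (flat g E) X Y p)\<^sup>2)"
proof
  fix p
  have tensor: "smooth_sym_tensor \<A> g"
    using metric by (auto simp: riemannian_metric_def lorentzian_metric_def)
  have g: "symmetric_pairing \<A> g"
    by (rule smooth_sym_tensor_pairing[OF tensor])
  have orthX: "flat g E q (X q) = 0" and orthY: "flat g E q (Y q) = 0" for q
    using X Y symmetric_pairing_commute[OF g E] by (simp_all add: flat_def)
  have eps: "\<epsilon> * \<epsilon> = 1"
    using metric by auto
  have nz: "1 + \<epsilon> * t \<noteq> 0"
  proof
    assume "1 + \<epsilon> * t = 0"
    then have "\<epsilon> * (1 + \<epsilon> * t) = 0"
      by simp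
    then have "\<epsilon> + (\<epsilon> * \<epsilon>) * t = 0"
      by (simp add: algebra_simps)
    then show False
      using eps t by simp
  qed
  have smoothB: "lie_bracket X Y \<in> smooth_vfields \<A>"
    by (rule lie_bracket_smooth[OF manifold LC X(1) Y(1)])
  note comparison = canonical_variation_koszul_comparison[OF g E LC LCt]
  note flat_orth = flat_derivative_orthogonal[OF tensor LC E]

  define a b c d where "a = g p (A_op D E X p) (X p)" and "b = g p (A_op D E Y p) (Y p)"
    and "c = g p (A_op D E X p) (Y p)" and "d = g p (A_op D E Y p) (X p)"
  have flatD: "flat g E p (D X X p) = -a" "flat g E p (D Y Y p) = -b"
    "flat g E p (D X Y p) = -c" "flat g E p (D Y X p) = -d"
    unfolding a_def b_def c_def d_def by (intro flat_orth X(1) Y(1) orthX orthY)+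
  have flat_bracket: "flat g E p (lie_bracket U V p) = flat g E p (D U V p) - flat g E p (D V U p)"
    if U: "U \<in> smooth_vfields \<A>" and V: "V \<in> smooth_vfields \<A>" for U V
    using levi_civita_bracket[OF LC g U V E, of p]
      symmetric_pairing_commute[OF g E lie_bracket_smooth[OF manifold LC U V], of p]
      symmetric_pairing_commute[OF g E levi_civita_smooth[OF LC U V], of p]
      symmetric_pairing_commute[OF g E levi_civita_smooth[OF LC V U], of p]
    by (simp add: flat_def)
  have bracket: "flat g E p (lie_bracket X Y p) = d - c" "flat g E p (lie_bracket Y X p) = c - d"
    "flat g E p (lie_bracket X X p) = 0" "flat g E p (lie_bracket Y Y p) = 0"
    using flat_bracket X(1) Y(1) by (simp_all add: flatD)
  have zero: "Z p (\<lambda>q. 0) = 0" if "Z \<in> smooth_vfields \<A>" for Z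
    using tensor X(1) smooth_vfields_tangent[OF that]
    by (intro tangent_zero_fun[where f = "\<lambda>q. g q (X q) (X q)"]) (auto simp: smooth_sym_tensor_def)
  have ext: "ext_deriv D (flat g E) X Y p = c - d"
    by (simp add: ext_deriv_def cov_deriv_form_def orthX orthY zero X(1) Y(1) flatD)

  have first_order:
    "(\<lambda>q. canonical_variation g E t q (Dt Y Y q) (X q)) = (\<lambda>q. g q (D Y Y q) (X q))"
    "(\<lambda>q. canonical_variation g E t q (Dt X Y q) (X q)) = (\<lambda>q. g q (D X Y q) (X q))"
    using comparison[OF Y(1) Y(1) X(1) orthY] comparison[OF X(1) Y(1) X(1) orthY]
    by (simp_all add: orthX orthY)
  \<comment> \<open>The bracket may have an \<open>E\<close>-component; the two other fields are orthogonal to \<open>E\<close>.\<close>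
  have bracket_term: "canonical_variation g E t p (Dt (lie_bracket X Y) Y p) (X p) =
      g p (D (lie_bracket X Y) Y p) (X p) + t / 2 * (c - d)\<^sup>2"
    using comparison[OF smoothB Y(1) X(1) orthY, of p]
    by (simp add: orthX bracket power2_eq_square algebra_simps)

  have flatDt: "2 * (1 + \<epsilon> * t) * flat g E p (Dt X X p) = - 2 * a"
    "2 * (1 + \<epsilon> * t) * flat g E p (Dt Y X p) = - 2 * d + \<epsilon> * t * (c - d)"
    using canonical_variation_flat_derivative[OF g E LC LCt X(1) X(1) orthX orthX, of p \<epsilon>]
      canonical_variation_flat_derivative[OF g E LC LCt Y(1) X(1) orthY orthX, of p \<epsilon>] unitary
    by (simp_all add: flatD bracket)
  have "(1 + \<epsilon> * t) * flat g E p (Dt X X p) = -a"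
    using flatDt(1) by linarith
  then have flatDtX: "flat g E p (Dt X X p) = -a / (1 + \<epsilon> * t)"
    using nz by (metis nonzero_mult_div_cancel_left)
  have flatDtYX: "flat g E p (Dt Y X p) = (- 2 * d + \<epsilon> * t * (c - d)) / (2 * (1 + \<epsilon> * t))"
    using flatDt(2) nz by (simp add: eq_divide_eq mult.commute)
  note pairing = canonical_variation_pairing_of_derivatives[OF g E LC LCt]
  have pair1: "canonical_variation g E t p (Dt Y Y p) (Dt X X p) =
      g p (D Y Y p) (D X X p) - t * (a * b) / (1 + \<epsilon> * t)"
    using pairing[OF Y(1) Y(1) X(1) X(1) orthY orthY orthX orthX, of p]
    by (simp add: bracket flatD flatDtX)
  have pair2: "canonical_variation g E t p (Dt X Y p) (Dt Y X p) =
      g p (D X Y p) (D Y X p)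
      + t / 2 * ((d - c) * flat g E p (Dt Y X p) - (c - d) * c) + t * flat g E p (Dt Y X p) * c"
    using pairing[OF X(1) Y(1) Y(1) X(1) orthX orthY orthY orthX, of p]
    by (simp add: bracket flatD algebra_simps)

  \<comment> \<open>What is left once the two curvature expansions are subtracted.\<close>
  have identity: "t * (a * b) / (1 + \<epsilon> * t)
      + (t / 2 * ((d - c) * flat g E p (Dt Y X p) - (c - d) * c) + t * flat g E p (Dt Y X p) * c)
      - t / 2 * (c - d)\<^sup>2
    = t / (1 + \<epsilon> * t) * (a * b - c * d - (4 + 3 * \<epsilon> * t) / 4 * (c - d)\<^sup>2)"
    using nz unfolding flatDtYX by (simp add: divide_simps) (simp add: power2_eq_square algebra_simps)
  show "canonical_variation g E t p (curvature Dt X Y Y p) (X p) =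
    g p (curvature D X Y Y p) (X p) +
    t / (1 + \<epsilon> * t) *
      (g p (A_op D E X p) (X p) * g p (A_op D E Y p) (Y p)
       - g p (A_op D E X p) (Y p) * g p (A_op D E Y p) (X p)
       - (4 + 3 * \<epsilon> * t) / 4 * (ext_deriv D (flat g E) X Y p)\<^sup>2)"
    unfolding ext a_def[symmetric] b_def[symmetric] c_def[symmetric] d_def[symmetric]
    using metric_curvature_expansion[OF manifold LC g X(1) Y(1) Y(1) X(1), of p]
      metric_curvature_expansion[OF manifold LCt canonical_variation_pairing[OF g E]
        X(1) Y(1) Y(1) X(1), of p]
      first_order bracket_term pair1 pair2 identity
    by simp
qed

end
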